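(* Let $\mathbb{F}$ be a field, $T\subseteq \mathbb{F}$ a finite subset with $0\in T$ and $|T|\geq 2$, $d\geq 2$ an integer, and $t$ a positive integer. Then $$ar_\ell(T^d,t)=\begin{cases}|T|^d & \text{if } t>\frac{|T|^d-1}{d},\\ 1+t(d-1) & \text{if } t(d-2)\geq |T|^{d-2}-1 \text{ and } t\leq\frac{|T|^d-1}{d},\\ |T|^{d-2}+t & \text{if } t(d-2)\leq |T|^{d-2}-1.\end{cases}$$
   Context: $T^d\subseteq\mathbb{F}^d$ is the set of vectors all of whose coordinates lie in $T$. For a finite set $E\subseteq\mathbb{F}^d$ spanning $\mathbb{F}^d$, a basis of $E$ is a linearly independent subset of $E$ of size $d$; given a coloring of $E$, a rainbow basis is such a basis whose elements have pairwise distinct colors, and $ar_\ell(E,t)$ is the maximum number $m$ such that there is a coloring of $E$ with exactly $m$ colors containing no $t$ pairwise disjoint rainbow bases.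
   Formalization: For d=2 the third condition t(d-2) ≤ |T|^{d-2}-1 always holds and would conflict with the first case when t > (|T|^2-1)/2, so for d=2 the third case is stated only for t ≤ (|T|^d-1)/d; the first case covers the rest. *)

theory Defs
  imports "HOL-Analysis.Cartesian_Space"
begin

definition cube :: "'a set \<Rightarrow> ('a ^ 'n) set" where
  "cube T = {x. \<forall>i. x $ i \<in> T}"

definition basis_of :: "('a::field ^ 'n) set \<Rightarrow> ('a ^ 'n) set \<Rightarrow> bool" where
  "basis_of E B \<longleftrightarrow> B \<subseteq> E \<and> vec.independent B \<and> card B = CARD('n)"

definition rainbow_basis ::
    "('a::field ^ 'n) set \<Rightarrow> ('a ^ 'n \<Rightarrow> 'c) \<Rightarrow> ('a ^ 'n) set \<Rightarrow> bool" where
  "rainbow_basis E c B \<longleftrightarrow> basis_of E B \<and> inj_on c B"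

text \<open>Bases are nonempty, so pairwise disjoint bases are distinct and a
  collection of \<open>t\<close> of them is a set of cardinality \<open>t\<close>.\<close>

definition has_disjoint_rainbow_bases ::
    "('a::field ^ 'n) set \<Rightarrow> ('a ^ 'n \<Rightarrow> 'c) \<Rightarrow> nat \<Rightarrow> bool" where
  "has_disjoint_rainbow_bases E c t \<longleftrightarrow>
     (\<exists>\<B>. finite \<B> \<and> card \<B> = t \<and> (\<forall>B\<in>\<B>. rainbow_basis E c B) \<and> pairwise disjnt \<B>)"

text \<open>Intended for finite \<open>E\<close>. Only finitely many colours occur, so they may be
  taken to be natural numbers.\<close>

definition ar_lin :: "('a::field ^ 'n) set \<Rightarrow> nat \<Rightarrow> nat" where
  "ar_lin E t =
     Max {m. \<exists>c :: 'a ^ 'n \<Rightarrow> nat. card (c ` E) = m \<and> \<not> has_disjoint_rainbow_bases E c t}"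

end

theory Submission
  imports Defs "HOL-Library.Disjoint_Sets" "HOL-Library.FuncSet"
begin

text \<open>
  Write \<open>q = |T|\<close>. A subspace \<open>F\<close> of dimension \<open>k\<close> meets \<open>T\<^sup>d\<close> in at most \<open>q\<^sup>k\<close> points, since
  \<open>k\<close> suitable coordinates determine a vector of \<open>F\<close>.

  Upper bound. Choose a spanning set \<open>R\<close> containing one point of each colour. By the bound on
  \<open>|T\<^sup>d \<inter> F|\<close>, the convexity of \<open>k \<mapsto> q\<^sup>k\<close> and the rank formula for the \<open>t\<close>-fold matroid union, there
  are \<open>t\<close> disjoint bases whose union contains more than \<open>t(d-1)\<close> points of \<open>R\<close>. If one of these bases
  is not rainbow, then the relation of sharing a colour does not connect all \<open>t\<close> bases, because a
  connected family containing a non-rainbow basis has at most \<open>t(d-1)\<close> colours. A symmetric exchange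
  of a repeated element with a basis of another component then reduces the number of repetitions.

  Lower bound. Give distinct colours to the points of a coordinate subspace of dimension \<open>k = 0\<close>
  or \<open>k = d-2\<close> and to \<open>t(d-1-k) - 1\<close> further points, and one more colour to everything else. Every
  rainbow basis uses at least \<open>d-1-k\<close> of the further points.
\<close>

section \<open>Packing disjoint bases\<close>

text \<open>For \<open>r\<close> the rank function of a matroid, these are the independent sets of its \<open>t\<close>-fold
  union (Rado--Horn).\<close>

definition sparse :: "('b set \<Rightarrow> nat) \<Rightarrow> nat \<Rightarrow> 'b set \<Rightarrow> bool" where
  "sparse r t J \<longleftrightarrow> (\<forall>X\<subseteq>J. card X \<le> t * r X)"

lemma ex_max_card:
  assumes "finite S" "P X" "\<And>Y. P Y \<Longrightarrow> Y \<subseteq> S"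
  shows "\<exists>Y. P Y \<and> (\<forall>Z. P Z \<longrightarrow> card Z \<le> card Y)"
  using ex_has_greatest_nat[of P X card "Suc (card S)"] assms
  by (metis card_mono less_Suc_eq_le)

context finite_dimensional_vector_space
begin

text \<open>This is the dimension formula for \<open>span A\<close> and \<open>span B\<close>,
  weakened because \<open>A \<inter> B\<close> may span less than the intersection of the two
  spans.\<close>

lemma dim_Un_Int_le: "dim (A \<union> B) + dim (A \<inter> B) \<le> dim A + dim B"
proof -
  have "dim (A \<union> B) = dim {x + y |x y. x \<in> span A \<and> y \<in> span B}"
    by (metis dim_span span_Un)
  moreover have "dim (A \<inter> B) \<le> dim (span A \<inter> span B)"
    by (intro dim_subset) (auto intro: span_base)
  ultimately show ?thesis
    using dim_sums_Int[OF subspace_span[of A] subspace_span[of B]] by simp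
qed

lemma independent_iff_card_le_dim:
  assumes "finite B"
  shows "independent B \<longleftrightarrow> card B \<le> dim B"
  using assms card_le_dim_spanning[of B B] independent_bound_general[of B] span_superset by blast

text \<open>This is Rado's theorem on independent transversals, for the sum of copies of the linear matroid
  indexed by \<open>I\<close>. If neither of two indices can be removed from \<open>A e0\<close>, then submodularity applied to
  the two violating sets contradicts the hypothesis.\<close>

lemma exists_independent_choice:
  assumes "finite J" "finite I" "\<And>e. e \<in> J \<Longrightarrow> A e \<subseteq> I"
    and "\<And>K. K \<subseteq> J \<Longrightarrow> card K \<le> (\<Sum>i\<in>I. dim {e\<in>K. i \<in> A e})"
  shows "\<exists>g. (\<forall>e\<in>J. g e \<in> A e) \<and> (\<forall>i\<in>I. independent {e\<in>J. g e = i})"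
  using assms(3,4)
\<comment> \<open>Each round deletes one index from one candidate set, until no candidate set has
  two elements.\<close>
proof (induction "\<Sum>e\<in>J. card (A e)" arbitrary: A rule: less_induct)
  case (less A)
  have fin_A: "finite (A e)" if "e \<in> J" for e
    using less.prems(1)[OF that] assms(2) finite_subset by blast
  show ?case
  proof (cases "\<exists>e\<in>J. \<exists>i\<in>A e. \<exists>j\<in>A e. i \<noteq> j")
    case True
    then obtain e0 i j where e0: "e0 \<in> J" "i \<in> A e0" "j \<in> A e0" "i \<noteq> j"
      by blast
    define A' where "A' k = A(e0 := A e0 - {k})" for k
    have A'_sub: "A' k e \<subseteq> A e" for k e
      by (auto simp: A'_def)
    have A'_less: "(\<Sum>e\<in>J. card (A' k e)) < (\<Sum>e\<in>J. card (A e))" if "k \<in> A e0" for k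
    proof (rule sum_strict_mono_ex1[OF assms(1)])
      show "\<forall>e\<in>J. card (A' k e) \<le> card (A e)"
        using A'_sub fin_A card_mono by blast
      have "card (A' k e0) < card (A e0)"
        using card_Diff1_less[OF fin_A[OF e0(1)] that] by (simp add: A'_def)
      then show "\<exists>e\<in>J. card (A' k e) < card (A e)" using e0(1) by blast
    qed
    have "\<exists>k\<in>{i, j}. \<forall>K\<subseteq>J. card K \<le> (\<Sum>l\<in>I. dim {e\<in>K. l \<in> A' k e})"
    proof (rule ccontr)
      assume "\<not> ?thesis"
      then obtain K L where
          K: "K \<subseteq> J" "(\<Sum>l\<in>I. dim {e\<in>K. l \<in> A' i e}) < card K" and
          L: "L \<subseteq> J" "(\<Sum>l\<in>I. dim {e\<in>L. l \<in> A' j e}) < card L"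
        by (auto simp: not_le)
      \<comment> \<open>A violating set contains \<open>e0\<close>, since otherwise the shrunken
        family agrees with \<open>A\<close> on it.\<close>
      have mem: "e0 \<in> M" if "M \<subseteq> J" "(\<Sum>l\<in>I. dim {e\<in>M. l \<in> A' k e}) < card M" for M k
      proof (rule ccontr)
        assume "e0 \<notin> M"
        then have "{e\<in>M. l \<in> A' k e} = {e\<in>M. l \<in> A e}" for l
          by (auto simp: A'_def)
        then show False using that less.prems(2)[of M] by simp
      qed
      have e0_KL: "e0 \<in> K" "e0 \<in> L" using mem K L by blast+
      have fin: "finite K" "finite L" using K L assms(1) finite_subset by blast+
      have "card (K \<union> L) + card (K \<inter> L - {e0})
          \<le> (\<Sum>l\<in>I. dim {e\<in>K \<union> L. l \<in> A e}) + (\<Sum>l\<in>I. dim {e\<in>K \<inter> L - {e0}. l \<in> A e})"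
        using K(1) L(1) by (intro add_mono less.prems(2)) auto
      also have "\<dots> \<le> (\<Sum>l\<in>I. dim {e\<in>K. l \<in> A' i e}) + (\<Sum>l\<in>I. dim {e\<in>L. l \<in> A' j e})"
        unfolding sum.distrib[symmetric]
      proof (rule sum_mono)
        fix l assume "l \<in> I"
        let ?K = "{e\<in>K. l \<in> A' i e}" and ?L = "{e\<in>L. l \<in> A' j e}"
        \<comment> \<open>Any \<open>l\<close> differs from \<open>i\<close> or from
          \<open>j\<close>, so \<open>e0\<close> survives on at least one side and may stay in the
          union. It may vanish on the other side, so it is dropped from the intersection.\<close>
        have "{e\<in>K \<union> L. l \<in> A e} \<subseteq> ?K \<union> ?L" "{e\<in>K \<inter> L - {e0}. l \<in> A e} \<subseteq> ?K \<inter> ?L"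
          using e0 e0_KL by (auto simp: A'_def)
        then have "dim {e\<in>K \<union> L. l \<in> A e} + dim {e\<in>K \<inter> L - {e0}. l \<in> A e}
            \<le> dim (?K \<union> ?L) + dim (?K \<inter> ?L)"
          by (intro add_mono dim_subset)
        also have "\<dots> \<le> dim ?K + dim ?L" by (rule dim_Un_Int_le)
        finally show "dim {e\<in>K \<union> L. l \<in> A e} + dim {e\<in>K \<inter> L - {e0}. l \<in> A e}
            \<le> dim ?K + dim ?L" .
      qed
      \<comment> \<open>Two strict inequalities gain 2, while leaving out \<open>e0\<close> costs
        only 1.\<close>
      also have "\<dots> + 2 \<le> card K + card L" using K(2) L(2) by simp
      also have "\<dots> = card (K \<union> L) + card (K \<inter> L)" using fin by (rule card_Un_Int)
      also have "card (K \<inter> L) = card (K \<inter> L - {e0}) + 1"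
        using e0_KL fin card_Suc_Diff1[of "K \<inter> L" e0] by simp
      finally show False by simp
    qed
    then obtain k where k: "k \<in> A e0" "\<forall>K\<subseteq>J. card K \<le> (\<Sum>l\<in>I. dim {e\<in>K. l \<in> A' k e})"
      using e0 by blast
    have "\<exists>g. (\<forall>e\<in>J. g e \<in> A' k e) \<and> (\<forall>i\<in>I. independent {e\<in>J. g e = i})"
      using less.prems(1) A'_sub k(2) by (intro less.hyps[OF A'_less[OF k(1)]]) blast+
    then show ?thesis using A'_sub by blast
  next
    case False
    have "A e \<noteq> {}" if "e \<in> J" for e
      using less.prems(2)[of "{e}"] that by (auto simp: Collect_conv_if)
    then obtain g where "\<forall>e\<in>J. g e \<in> A e"
      using bchoice[of J "\<lambda>e i. i \<in> A e"] by blast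
    then have g: "g e \<in> A e" if "e \<in> J" for e using that by blast
    have A_eq: "i \<in> A e \<longleftrightarrow> g e = i" if "e \<in> J" for e i
      using g False that by blast
    let ?J = "\<lambda>i. {e\<in>J. g e = i}"
    have le: "dim (?J i) \<le> card (?J i)" for i
      using assms(1) by (intro dim_le_card) (auto intro: span_base)
    have "card J \<le> (\<Sum>i\<in>I. dim {e\<in>J. i \<in> A e})"
      by (rule less.prems(2)) simp
    also have "\<dots> = (\<Sum>i\<in>I. dim (?J i))"
      by (intro sum.cong arg_cong[where f = dim]) (auto simp: A_eq)
    finally have "card J \<le> (\<Sum>i\<in>I. dim (?J i))" .
    moreover have "card J = (\<Sum>i\<in>I. card (?J i))"
    proof -
      have "(\<Sum>i\<in>I. \<Sum>e\<in>?J i. 1) = (\<Sum>e\<in>J. 1::nat)"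
        using g less.prems(1) by (intro sum.group assms) blast
      then show ?thesis by simp
    qed
    \<comment> \<open>No dimension exceeds the corresponding cardinality, so equal sums make every
      class independent.\<close>
    ultimately have "(\<Sum>i\<in>I. dim (?J i)) = (\<Sum>i\<in>I. card (?J i))"
      by (simp add: antisym le sum_mono)
    then have "\<forall>i\<in>I. card (?J i) \<le> dim (?J i)"
      using sum_mono_inv[of "\<lambda>i. dim (?J i)" I "\<lambda>i. card (?J i)"] le assms(2) by fastforce
    then show ?thesis
      using g assms(1) by (intro exI[of _ g]) (auto simp: independent_iff_card_le_dim)
  qed
qed

text \<open>In Rado's condition let every index be available to every element. The sum of dimensions
  becomes \<open>t * dim K\<close>, so the condition is sparsity.\<close>

theorem sparse_partition:
  assumes "finite J" "sparse dim t J"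
  shows "\<exists>g. g ` J \<subseteq> {..<t} \<and> (\<forall>i<t. independent {e\<in>J. g e = i})"
proof -
  have "\<exists>g. (\<forall>e\<in>J. g e \<in> {..<t}) \<and> (\<forall>i\<in>{..<t}. independent {e\<in>J. g e = i})"
    using assms by (intro exists_independent_choice) (auto simp: sparse_def)
  then show ?thesis by auto
qed

text \<open>The slack \<open>t * dim X - card X\<close> is submodular and nonnegative on subsets of
  \<open>J\<close>, so its zeros are closed under union. Hence a largest tight set contains all
  others.\<close>

lemma tight_Un:
  assumes "finite J" "sparse dim t J" "X \<subseteq> J" "Y \<subseteq> J" "card X = t * dim X" "card Y = t * dim Y"
  shows "card (X \<union> Y) = t * dim (X \<union> Y)"
proof -
  have "t * dim (X \<union> Y) + t * dim (X \<inter> Y) \<le> t * dim X + t * dim Y"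
    using dim_Un_Int_le[of X Y] by (metis add_mult_distrib2 mult_le_mono2)
  moreover have "card X + card Y = card (X \<union> Y) + card (X \<inter> Y)"
    using assms by (intro card_Un_Int) (auto intro: finite_subset)
  moreover have "card (X \<union> Y) \<le> t * dim (X \<union> Y)" "card (X \<inter> Y) \<le> t * dim (X \<inter> Y)"
    using assms unfolding sparse_def by (meson Un_least inf.coboundedI1)+
  ultimately show ?thesis using assms by linarith
qed

text \<open>This is the rank formula for the matroid union, with a subspace \<open>F\<close>
  attaining the minimum: the span of the largest tight subset of a largest sparse \<open>J\<close>.
  Starting from \<open>J0\<close> allows a sparse set found in a smaller ground set to be
  extended.\<close>

lemma maximal_sparse:
  assumes "finite S" "J0 \<subseteq> S" "sparse dim t J0" "t > 0"
  obtains J F where "J0 \<subseteq> J" "J \<subseteq> S" "sparse dim t J" "subspace F"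
    "card J = card (S - F) + t * dim F"
proof -
  define P where "P J \<longleftrightarrow> J0 \<subseteq> J \<and> J \<subseteq> S \<and> sparse dim t J" for J
  have "P J0" "\<And>J. P J \<Longrightarrow> J \<subseteq> S" using assms by (simp_all add: P_def)
  with assms(1) have "\<exists>J. P J \<and> (\<forall>Z. P Z \<longrightarrow> card Z \<le> card J)"
    by (rule ex_max_card)
  then obtain J where PJ: "P J" and J_max: "\<forall>Z. P Z \<longrightarrow> card Z \<le> card J"
    by metis
  from PJ have J: "J0 \<subseteq> J" "J \<subseteq> S" "sparse dim t J" by (simp_all add: P_def)
  have fin: "finite J" using J assms finite_subset by blast
  define Q where "Q X \<longleftrightarrow> X \<subseteq> J \<and> card X = t * dim X" for X
  have "Q {}" "\<And>X. Q X \<Longrightarrow> X \<subseteq> J" by (simp_all add: Q_def)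
  with fin have "\<exists>X. Q X \<and> (\<forall>Z. Q Z \<longrightarrow> card Z \<le> card X)"
    by (rule ex_max_card)
  then obtain X where QX: "Q X" and X_max: "\<forall>Z. Q Z \<longrightarrow> card Z \<le> card X"
    by metis
  from QX have X: "X \<subseteq> J" "card X = t * dim X" by (simp_all add: Q_def)
  have X_top: "Y \<subseteq> X" if "Y \<subseteq> J" "card Y = t * dim Y" for Y
  proof -
    have "card (X \<union> Y) \<le> card X"
      using X that tight_Un[OF fin J(3)] by (intro X_max[rule_format]) (simp add: Q_def)
    then show ?thesis
      by (metis Un_least Un_upper1 Un_upper2 X(1) card_seteq fin finite_subset that(1))
  qed
  have span_X: "e \<in> span X" if "e \<in> S - J" for e
  proof -
    have "\<not> sparse dim t (insert e J)"
    proof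
      assume "sparse dim t (insert e J)"
      then have "card (insert e J) \<le> card J" using that J by (intro J_max[rule_format]) (auto simp: P_def)
      then show False using that fin by simp
    qed
    then obtain Y where Y: "Y \<subseteq> insert e J" "t * dim Y < card Y"
      by (auto simp: sparse_def not_le)
    have "e \<in> Y" using Y J(3) by (meson leD sparse_def subset_insert)
    define Z where "Z = Y - {e}"
    have Z: "Z \<subseteq> J" "Y = insert e Z" "e \<notin> Z"
      using Y \<open>e \<in> Y\<close> by (auto simp: Z_def)
    then have "finite Z" using fin finite_subset by blast
    have "card Z \<le> t * dim Z" using J(3) Z(1) by (simp add: sparse_def)
    moreover have "t * dim Y \<le> card Z" using Y Z \<open>finite Z\<close> by simp
    moreover have "t * dim Z \<le> t * dim Y" using Z by (intro mult_le_mono2 dim_subset) auto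
    \<comment> \<open>The bounds form a cycle and are therefore equalities: \<open>Z\<close> is
      tight, hence inside \<open>X\<close>, and adding \<open>e\<close> does not raise its
      dimension.\<close>
    ultimately have "card Z = t * dim Z" "t * dim Y = t * dim Z" by linarith+
    with assms(4) have "e \<in> span Z" "Z \<subseteq> X"
      using Z X_top by (auto simp: dim_insert split: if_splits)
    then show ?thesis using span_mono by blast
  qed
  \<comment> \<open>Sparsity leaves no room in \<open>span X\<close> for elements of
    \<open>J\<close> beyond the tight set \<open>X\<close>.\<close>
  have "card (J \<inter> span X) \<le> t * dim (J \<inter> span X)"
    using J(3) by (simp add: sparse_def)
  also have "\<dots> \<le> t * dim X" by (intro mult_le_mono2 dim_mono) auto
  finally have "card (J \<inter> span X) \<le> card X" using X by simp
  then have "J \<inter> span X = X"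
    using X fin span_superset[of X] card_seteq[of "J \<inter> span X" X] by auto
  moreover have "J - span X = S - span X" using J span_X by blast
  moreover have "card J = card (J - span X) + card (J \<inter> span X)"
    using fin by (simp add: card_Diff_subset_Int card_mono)
  ultimately have "card J = card (S - span X) + t * dim (span X)"
    using X by simp
  then show ?thesis using that J by (metis subspace_span)
qed

section \<open>Rearranging disjoint bases into rainbow bases\<close>

text \<open>Take a smallest \<open>D \<subseteq> C\<close> whose span contains \<open>a\<close>,
  that is, the fundamental circuit of \<open>a\<close> without \<open>a\<close>. Since
  \<open>a\<close> is outside \<open>span (B - {a})\<close>, so is some \<open>x\<close> in
  \<open>D\<close>; and no element of \<open>D\<close> can be removed from \<open>C\<close> without
  losing \<open>a\<close> from the span.\<close>

lemma symmetric_exchange: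
  assumes "independent B" "independent C" "a \<in> B" "a \<in> span C"
  obtains x where "x \<in> C" "x \<notin> span (B - {a})" "a \<notin> span (C - {x})"
proof -
  have fin: "finite C" using assms(2) by (rule finiteI_independent)
  have "\<exists>D. (D \<subseteq> C \<and> a \<in> span D) \<and> (\<forall>D'. D' \<subseteq> C \<and> a \<in> span D' \<longrightarrow> card D \<le> card D')"
    by (rule ex_has_least_nat[of _ C]) (use assms in auto)
  then obtain D where D: "D \<subseteq> C" "a \<in> span D"
    and D_min: "\<And>D'. D' \<subseteq> C \<Longrightarrow> a \<in> span D' \<Longrightarrow> card D \<le> card D'"
    by blast
  have "a \<notin> span (B - {a})" using assms(1,3) by (auto simp: dependent_def)
  then have "\<not> D \<subseteq> span (B - {a})" using D(2) span_minimal subspace_span by blast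
  then obtain x where x: "x \<in> D" "x \<notin> span (B - {a})" by blast
  have "finite D" using D(1) fin finite_subset by blast
  have "a \<notin> span (D - {x})"
  proof
    assume "a \<in> span (D - {x})"
    then have "card D \<le> card (D - {x})" using D(1) by (intro D_min) auto
    then show False using x \<open>finite D\<close> by (metis card_Diff1_less leD)
  qed
  moreover have "a \<in> span (insert x (D - {x}))" using D(2) x by (simp add: insert_absorb)
  ultimately have "x \<in> span (insert a (D - {x}))" by (rule in_span_insert[rotated])
  have "a \<notin> span (C - {x})"
  proof
    assume a: "a \<in> span (C - {x})"
    have "insert a (D - {x}) \<subseteq> span (C - {x})"
      using a D(1) by (auto intro: span_base)
    then have "x \<in> span (C - {x})"
      using \<open>x \<in> span (insert a (D - {x}))\<close> span_minimal subspace_span by blast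
    then show False using assms(2) x D(1) by (auto simp: dependent_def)
  qed
  then show ?thesis using that x D(1) by blast
qed

lemma independent_swap:
  assumes "independent B" "x \<notin> span (B - {a})"
  shows "independent (insert x (B - {a}))"
  using assms by (metis Diff_subset independent_insert independent_mono)

text \<open>Induction on the total number of missing colours. Exchanges preserve the union of the
  bases, so the hypothesis on its colours persists.\<close>

theorem rainbow_rearrangement:
  assumes "finite I" "\<And>i. i \<in> I \<Longrightarrow> independent (B i) \<and> card (B i) = dimension"
    and "disjoint_family_on B I"
    and "card I * (dimension - 1) < card (c ` (\<Union>i\<in>I. B i))"
  shows "\<exists>B'. (\<forall>i\<in>I. independent (B' i) \<and> card (B' i) = dimension \<and> inj_on c (B' i)) \<and>
     disjoint_family_on B' I \<and> (\<Union>i\<in>I. B' i) = (\<Union>i\<in>I. B i)"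
  using assms(2-)
proof (induction "\<Sum>i\<in>I. dimension - card (c ` B i)" arbitrary: B rule: less_induct)
  case (less B)
  have fin: "finite (B i)" if "i \<in> I" for i using less.prems(1)[OF that] finiteI_independent by blast
  show ?case
  proof (cases "\<forall>i\<in>I. inj_on c (B i)")
    case True
    then show ?thesis using less.prems by blast
  next
    case False
    then obtain i a a' where i: "i \<in> I" and a: "a \<in> B i" "a' \<in> B i" "a \<noteq> a'" "c a = c a'"
      by (auto simp: inj_on_def)
    have card_i: "card (c ` B i) < dimension"
      using a fin[OF i] less.prems(1)[OF i] card_image_le[of "B i" c] eq_card_imp_inj_on[of "B i" c]
      by (metis inj_onD nat_less_le)
    \<comment> \<open>A maximal \<open>K\<close> with \<open>P K\<close> is closed under sharing colours, and is not all of \<open>I\<close>.\<close>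
    define P where
      "P K \<longleftrightarrow> i \<in> K \<and> K \<subseteq> I \<and> card (c ` (\<Union>k\<in>K. B k)) \<le> card K * (dimension - 1)" for K
    have "P {i}" "\<And>K. P K \<Longrightarrow> K \<subseteq> I" using i card_i by (simp_all add: P_def)
    with assms(1) have "\<exists>K. P K \<and> (\<forall>Z. P Z \<longrightarrow> card Z \<le> card K)"
      by (rule ex_max_card)
    then obtain K where PK: "P K" and K_max: "\<forall>Z. P Z \<longrightarrow> card Z \<le> card K"
      by metis
    from PK have K: "i \<in> K" "K \<subseteq> I" "card (c ` (\<Union>k\<in>K. B k)) \<le> card K * (dimension - 1)"
      by (simp_all add: P_def)
    \<comment> \<open>The hypothesis on the number of colours says that \<open>P I\<close>
      fails.\<close>
    obtain j where j: "j \<in> I" "j \<notin> K" using K less.prems(3) by (metis leD subset_antisym subsetI)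
    have finK: "finite K" using K(2) assms(1) finite_subset by blast
    \<comment> \<open>With a shared colour, \<open>B j\<close> would contribute at most
      \<open>dimension - 1\<close> new colours, and \<open>j\<close> could join
      \<open>K\<close>.\<close>
    have "c ` (\<Union>k\<in>K. B k) \<inter> c ` B j = {}"
    proof (rule ccontr)
      assume ne: "c ` (\<Union>k\<in>K. B k) \<inter> c ` B j \<noteq> {}"
      let ?X = "c ` (\<Union>k\<in>K. B k)" and ?Y = "c ` B j"
      have finX: "finite ?X" "finite ?Y" using K(2) fin finK j(1) by auto
      have "card (?X \<union> ?Y) + card (?X \<inter> ?Y) = card ?X + card ?Y"
        using finX by (rule card_Un_Int[symmetric])
      moreover have "card (?X \<inter> ?Y) \<ge> 1" using ne finX by (simp add: Suc_leI card_gt_0_iff)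
      moreover have "card ?Y \<le> dimension"
        using card_image_le[OF fin[OF j(1)], of c] less.prems(1)[OF j(1)] by simp
      ultimately have "card (?X \<union> ?Y) \<le> card (insert j K) * (dimension - 1)"
        using K(3) j finK card_i by simp
      then have "card (insert j K) \<le> card K"
        using K j by (intro K_max[rule_format]) (simp add: P_def image_Un Un_commute)
      then show False using j finK by simp
    qed
    then have disj: "c ` B i \<inter> c ` B j = {}" using K(1) by blast
    have "a \<in> span (B j)"
      using less.prems(1)[OF j(1)] dim_eq_card_independent[of "B j"] dim_eq_full[of "B j"] by auto
    then obtain x where x: "x \<in> B j" "x \<notin> span (B i - {a})" "a \<notin> span (B j - {x})"
      using symmetric_exchange[of "B i" "B j" a] less.prems(1) i j(1) a(1) by blast
    define B' where "B' = B(i := insert x (B i - {a}), j := insert a (B j - {x}))"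
    have ij: "i \<noteq> j" using K j by blast
    have B': "B' i = insert x (B i - {a})" "B' j = insert a (B j - {x})"
        "\<And>k. k \<noteq> i \<Longrightarrow> k \<noteq> j \<Longrightarrow> B' k = B k"
      using ij by (auto simp: B'_def)
    have notin: "x \<notin> B i" "a \<notin> B j" using disj x a by blast+
    have cards: "card (B' i) = card (B i)" "card (B' j) = card (B j)"
      using notin x(1) a(1) fin i j(1) card_Suc_Diff1[of "B i" a] card_Suc_Diff1[of "B j" x]
      by (simp_all add: B' del: card_Diff_insert)
    have indep: "independent (B' i)" "independent (B' j)"
      using independent_swap[of "B i" x a] independent_swap[of "B j" a x] x less.prems(1) i j(1)
      by (simp_all add: B')
    have all: "independent (B' k) \<and> card (B' k) = dimension" if "k \<in> I" for k
      using that indep cards less.prems(1) B'(3) i j by metis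
    have un: "(\<Union>k\<in>I. B' k) = (\<Union>k\<in>I. B k)"
    proof -
      have "(\<Union>k\<in>I. f k) = f i \<union> f j \<union> (\<Union>k\<in>I - {i, j}. f k)" for f :: "_ \<Rightarrow> 'b set"
        using i j by auto
      from this[of B] this[of B'] show ?thesis using x(1) a(1) by (auto simp: B')
    qed
    have dis: "disjoint_family_on B' I"
    proof -
      have "B k \<inter> B l = {}" if "k \<in> I" "l \<in> I" "k \<noteq> l" for k l
        using that less.prems(2) by (auto simp: disjoint_family_on_def)
      then show ?thesis
        unfolding disjoint_family_on_def
        using x(1) a(1) notin i j ij by (auto simp: B'_def)
    qed
    \<comment> \<open>The partner \<open>a'\<close> preserves the colour of \<open>a\<close>, so
      \<open>B i\<close> gains the colour of \<open>x\<close> and loses none.\<close>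
    have ci: "c ` (B i - {a}) = c ` B i" using a by (auto simp: image_iff)
    have "c x \<notin> c ` B i" using disj x(1) by blast
    then have more_i: "card (c ` B' i) = Suc (card (c ` B i))"
      using fin[OF i] by (simp add: B' ci)
    \<comment> \<open>\<open>B j\<close> loses at most the colour of \<open>x\<close> and gains that
      of \<open>a\<close>, which is new there.\<close>
    have more_j: "card (c ` B' j) \<ge> card (c ` B j)"
    proof -
      have eq: "c ` B j = insert (c x) (c ` (B j - {x}))" using x(1) by blast
      have "card (c ` B j) \<le> Suc (card (c ` (B j - {x})))"
        by (subst eq) (use fin[OF j(1)] in \<open>simp add: card_insert_if\<close>)
      moreover have "c a \<notin> c ` (B j - {x})" using disj a(1) by blast
      ultimately show ?thesis using fin[OF j(1)] by (simp add: B')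
    qed
    have "(\<Sum>k\<in>I. dimension - card (c ` B' k)) < (\<Sum>k\<in>I. dimension - card (c ` B k))"
    proof (rule sum_strict_mono_ex1[OF assms(1)])
      show "\<forall>k\<in>I. dimension - card (c ` B' k) \<le> dimension - card (c ` B k)"
      proof
        fix k
        have "card (c ` B k) \<le> card (c ` B' k)"
          using more_i more_j B'(3)[of k] by (cases "k = i"; cases "k = j") auto
        then show "dimension - card (c ` B' k) \<le> dimension - card (c ` B k)" by simp
      qed
      show "\<exists>k\<in>I. dimension - card (c ` B' k) < dimension - card (c ` B k)"
        using i card_i more_i by (intro bexI[of _ i]) auto
    qed
    then have "\<exists>B''. (\<forall>i\<in>I. independent (B'' i) \<and> card (B'' i) = dimension \<and> inj_on c (B'' i)) \<and>
       disjoint_family_on B'' I \<and> (\<Union>i\<in>I. B'' i) = (\<Union>i\<in>I. B' i)"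
      using all dis less.prems(3) un by (intro less.hyps) auto
    then show ?thesis using un by simp
  qed
qed

end

section \<open>The cube\<close>

lemma card_cube_supported:
  fixes T :: "'a::field set" and K :: "'n::finite set"
  assumes "finite T" "0 \<in> T"
  shows "finite {x \<in> cube T. \<forall>i. i \<notin> K \<longrightarrow> x $ i = 0}" (is "finite ?F")
    and "card {x \<in> cube T. \<forall>i. i \<notin> K \<longrightarrow> x $ i = 0} = card T ^ card K"
proof -
  have "bij_betw (\<lambda>x. restrict (($) x) K) ?F (K \<rightarrow>\<^sub>E T)"
    by (rule bij_betw_byWitness[where f' = "\<lambda>f. \<chi> i. if i \<in> K then f i else 0"])
      (use assms(2) in \<open>auto simp: cube_def vec_eq_iff fun_eq_iff PiE_def extensional_def\<close>)
  then show "finite ?F" "card ?F = card T ^ card K"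
    using assms(1) by (auto simp: bij_betw_finite bij_betw_same_card card_PiE intro!: finite_PiE)
qed

lemma card_cube:
  fixes T :: "'a::field set"
  assumes "finite T" "0 \<in> T"
  shows "finite (cube T :: ('a ^ 'n::finite) set)"
    and "card (cube T :: ('a ^ 'n::finite) set) = card T ^ CARD('n)"
  using card_cube_supported[OF assms, of "UNIV :: 'n set"] by simp_all

text \<open>Extend a basis of \<open>F\<close> to the whole space by unit vectors. These span a
  complement of \<open>F\<close>, so a vector of \<open>F\<close> is determined by the coordinates
  whose unit vectors were not added, and there are \<open>vec.dim F\<close> of them.\<close>

lemma card_cube_Int_subspace_le:
  fixes T :: "'a::field set" and F :: "('a ^ 'n::finite) set"
  assumes "finite T" "vec.subspace F"
  shows "card (cube T \<inter> F) \<le> card T ^ vec.dim F"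
proof -
  obtain B where B: "vec.independent B" "vec.span B = F" "card B = vec.dim F"
    using vec.basis_subspace_exists[OF assms(2)] by blast
  obtain D where D: "B \<subseteq> D" "D \<subseteq> B \<union> cart_basis" "vec.independent D" "B \<union> cart_basis \<subseteq> vec.span D"
    using vec.maximal_independent_subset_extend[OF _ B(1), of "B \<union> cart_basis"] by blast
  have finD: "finite D" using D(3) by (rule vec.finiteI_independent)
  have "vec.span cart_basis \<subseteq> vec.span D"
    using D(4) by (intro vec.span_minimal vec.subspace_span) auto
  then have spanD: "vec.span D = UNIV" by auto
  have dimD: "card D = CARD('n)"
    using vec.dim_span_eq_card_independent[OF D(3)] spanD vec_dim_card[where 'a = 'a and 'n = 'n] by simp
  define C where "C = D - B"
  define N where "N = {i. axis i 1 \<in> C}"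
  have C_N: "C = (\<lambda>i. axis i 1) ` N"
    using D(2) by (auto simp: N_def C_def cart_basis_def)
  have "inj_on (\<lambda>i. axis i (1::'a)) N" by (auto simp: inj_on_def axis_eq_axis)
  then have "card N = card C" by (simp add: C_N card_image)
  also have "\<dots> = CARD('n) - vec.dim F"
    using dimD B(3) D(1) finD by (simp add: C_def card_Diff_subset finite_subset)
  finally have cardN: "card (- N) = vec.dim F"
    using dimD B(3) card_mono[OF finD D(1)] by (simp add: Compl_eq_Diff_UNIV card_Diff_subset)
  have "vec.dim (F \<inter> vec.span C) = 0"
  proof -
    have "{x + y |x y. x \<in> F \<and> y \<in> vec.span C} = UNIV"
      using vec.span_Un[of B C] B(2) D(1) spanD by (simp add: C_def Un_absorb1)
    moreover have "vec.dim (vec.span C) = card C"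
      by (intro vec.dim_span_eq_card_independent vec.independent_mono[OF D(3)]) (auto simp: C_def)
    moreover have "card C + card B = CARD('n)"
      using dimD D(1) finD card_mono[OF finD D(1)] by (simp add: C_def card_Diff_subset finite_subset)
    ultimately show ?thesis
      using vec.dim_sums_Int[OF assms(2) vec.subspace_span[of C]] B(3)
        vec_dim_card[where 'a = 'a and 'n = 'n] by (simp del: vec.dim_eq_0)
  qed
  then have trivial: "F \<inter> vec.span C \<subseteq> {0}" by (simp only: vec.dim_eq_0)
  have "inj_on (\<lambda>x. restrict (($) x) (- N)) (cube T \<inter> F)"
  proof (rule inj_onI)
    fix x y assume xy: "x \<in> cube T \<inter> F" "y \<in> cube T \<inter> F"
      and eq: "restrict (($) x) (- N) = restrict (($) y) (- N)"
    have zero: "(x - y) $ i = 0" if "i \<notin> N" for i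
      using fun_cong[OF eq, of i] that by simp
    \<comment> \<open>Coordinates outside \<open>N\<close> vanish, which leaves a combination of the
      unit vectors in \<open>C\<close>.\<close>
    have "(x - y) $ i *s axis i 1 \<in> vec.span C" for i
      using zero[of i] by (cases "i \<in> N") (auto simp: C_N vec.span_zero intro: vec.span_scale vec.span_base)
    then have "(\<Sum>i\<in>UNIV. (x - y) $ i *s axis i 1) \<in> vec.span C"
      by (intro vec.span_sum)
    then have "x - y \<in> vec.span C" by (simp only: basis_expansion)
    moreover have "x - y \<in> F" using xy assms(2) by (auto intro: vec.subspace_diff)
    ultimately show "x = y" using trivial by auto
  qed
  moreover have "(\<lambda>x. restrict (($) x) (- N)) ` (cube T \<inter> F) \<subseteq> (- N) \<rightarrow>\<^sub>E T"
    by (auto simp: cube_def)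
  moreover have "finite ((- N) \<rightarrow>\<^sub>E T)" using assms(1) by (intro finite_PiE) auto
  ultimately have "card (cube T \<inter> F) \<le> card ((- N) \<rightarrow>\<^sub>E T)"
    by (rule card_inj_on_le)
  then show ?thesis using cardN by (simp add: card_PiE)
qed

lemma span_cube:
  fixes T :: "'a::field set"
  assumes "finite T" "0 \<in> T" "card T \<ge> 2"
  shows "vec.span (cube T :: ('a ^ 'n::finite) set) = UNIV"
proof -
  have "\<not> T \<subseteq> {0}" using assms(3) card_mono[of "{0}" T] by auto
  then obtain a where a: "a \<in> T" "a \<noteq> 0" by blast
  have "axis i 1 \<in> vec.span (cube T)" for i :: 'n
  proof -
    have "axis i a \<in> vec.span (cube T)"
      using a assms(2) by (intro vec.span_base) (auto simp: cube_def axis_def)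
    then have "inverse a *s axis i a \<in> vec.span (cube T)" by (rule vec.span_scale)
    moreover have "inverse a *s axis i a = axis i (1::'a)" using a(2) by (simp add: vec_eq_iff axis_def)
    ultimately show ?thesis by simp
  qed
  then have "vec.span cart_basis \<subseteq> vec.span (cube T :: ('a ^ 'n) set)"
    by (intro vec.span_minimal vec.subspace_span) (auto simp: cart_basis_def)
  then show ?thesis by auto
qed

section \<open>Convexity inequalities for powers\<close>

text \<open>The left side is \<open>q - 1\<close> times a geometric sum of \<open>k\<close> terms,
  each at most \<open>q ^ k\<close>.\<close>

lemma power_minus_one_le:
  fixes q :: int
  assumes "q \<ge> 1"
  shows "q ^ k - 1 \<le> int k * ((q - 1) * q ^ k)"
proof (induction k)
  case (Suc k)
  have "q ^ Suc k - 1 = q * (q ^ k - 1) + (q - 1) * 1" by (simp add: algebra_simps)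
  also have "\<dots> \<le> q * (int k * ((q - 1) * q ^ k)) + (q - 1) * q ^ Suc k"
    using Suc assms by (intro add_mono mult_left_mono one_le_power) auto
  also have "\<dots> = int (Suc k) * ((q - 1) * q ^ Suc k)" by (simp add: algebra_simps)
  finally show ?case .
qed simp

text \<open>By convexity of the exponential, chords starting at exponent 0 have increasing slope.
  Clearing denominators admits \<open>k = 0\<close>; working over the integers avoids truncated
  subtraction.\<close>

lemma power_minus_one_slope_le:
  fixes q :: int
  assumes "q \<ge> 1" "k \<le> n"
  shows "int n * (q ^ k - 1) \<le> int k * (q ^ n - 1)"
  using assms(2)
proof (induction n rule: dec_induct)
  case (step n)
  have "q ^ k - 1 \<le> int k * ((q - 1) * q ^ k)" by (rule power_minus_one_le[OF assms(1)])
  also have "\<dots> \<le> int k * ((q - 1) * q ^ n)"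
    using assms(1) step by (intro mult_left_mono power_increasing) auto
  finally show ?case using step.IH by (simp add: algebra_simps)
qed simp

text \<open>The left side is convex in \<open>k\<close>, so it suffices to compare at the ends:
  \<open>k = 0\<close> is the hypothesis and \<open>k = d\<close> is an equality.\<close>

lemma power_add_linear_le_power:
  fixes q t d k :: nat
  assumes "q \<ge> 1" "t * d + 1 \<le> q ^ d" "k \<le> d" "d > 0"
  shows "q ^ k + t * (d - k) \<le> q ^ d"
proof -
  have "int (t * d + 1) \<le> int (q ^ d)" using assms(2) by (simp only: of_nat_le_iff)
  then have "int t * int d \<le> int q ^ d - 1" by simp
  then have "(int t * int d) * int (d - k) \<le> (int q ^ d - 1) * int (d - k)"
    by (rule mult_right_mono) simp
  moreover have "int d * (int q ^ k - 1) \<le> int k * (int q ^ d - 1)"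
    using assms by (intro power_minus_one_slope_le) auto
  ultimately have "int d * (int q ^ k + int t * int (d - k)) \<le> int d * int q ^ d"
    using assms(3) by (simp add: of_nat_diff algebra_simps)
  then have "int q ^ k + int t * int (d - k) \<le> int q ^ d" using assms(4) by simp
  then show ?thesis by (metis of_nat_add of_nat_le_iff of_nat_mult of_nat_power)
qed

text \<open>Again by convexity in \<open>k\<close>: the last two hypotheses are the cases
  \<open>k = 0\<close> and \<open>k = n\<close>, and they are combined with weights
  \<open>n - k\<close> and \<open>k\<close>.\<close>

lemma power_add_linear_le:
  fixes q t n k M :: nat
  assumes "q \<ge> 1" "k \<le> n" "1 + t * (n + 1) \<le> M" "q ^ n + t \<le> M"
  shows "q ^ k + t * (n + 1 - k) \<le> M"
proof (cases "n = 0")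
  case False
  have "int n * (int q ^ k - 1) \<le> int k * (int q ^ n - 1)"
    using assms by (intro power_minus_one_slope_le) auto
  moreover have "int (n - k) * (1 + int t * (int n + 1)) \<le> int (n - k) * int M"
  proof (rule mult_left_mono)
    have "int (1 + t * (n + 1)) \<le> int M" using assms(3) by (simp only: of_nat_le_iff)
    then show "1 + int t * (int n + 1) \<le> int M" by (simp add: algebra_simps)
  qed simp
  moreover have "int k * (int q ^ n + int t) \<le> int k * int M"
    using assms(4) by (intro mult_left_mono) (auto simp flip: of_nat_power of_nat_add)
  ultimately have "int n * (int q ^ k + int t * int (n + 1 - k)) \<le> int n * int M"
    using assms(2) by (simp add: of_nat_diff algebra_simps)
  then have "int q ^ k + int t * int (n + 1 - k) \<le> int M" using False by simp
  then show ?thesis by (metis of_nat_add of_nat_le_iff of_nat_mult of_nat_power)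
qed (use assms in auto)

section \<open>The upper bound\<close>

text \<open>A single swap suffices. If the representatives do not span, replace one of them by a
  point of its colour outside their span; the others are too many to have dimension at most
  \<open>CARD('n) - 2\<close>.\<close>

lemma spanning_transversal:
  fixes T :: "'a::field set" and c :: "'a ^ 'n::finite \<Rightarrow> 'c"
  assumes T: "finite T" "0 \<in> T" "card T \<ge> 2"
    and m: "card T ^ (CARD('n) - 2) + 1 < card (c ` (cube T :: ('a ^ 'n) set))"
  obtains R :: "('a ^ 'n) set"
  where "R \<subseteq> cube T" "inj_on c R" "c ` R = c ` cube T" "vec.dim R = CARD('n)"
proof -
  let ?E = "cube T :: ('a ^ 'n) set"
  obtain R where R: "R \<subseteq> ?E" "inj_on c R" "c ` R = c ` ?E"
    using subset_image_inj[of "c ` ?E" c ?E] by (metis subset_refl)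
  have finR: "finite R" using R(1) card_cube(1)[OF T(1,2)] finite_subset by blast
  have cardR: "card R = card (c ` ?E)" using R(2,3) by (metis card_image)
  show ?thesis
  proof (cases "vec.span R = UNIV")
    case True
    then have "vec.dim R = CARD('n)" by (metis vec.dim_span vec_dim_card)
    then show ?thesis using that R by blast
  next
    case False
    have "\<not> ?E \<subseteq> vec.span R"
      using False span_cube[OF T, where 'n = 'n] vec.span_minimal[OF _ vec.subspace_span, of ?E R] by auto
    then obtain e where e: "e \<in> ?E" "e \<notin> vec.span R" by blast
    then obtain r where r: "r \<in> R" "c r = c e" using R(3) by (metis imageE imageI)
    \<comment> \<open>The \<open>+ 1\<close> in \<open>m\<close> pays for the removal of
      \<open>r\<close>.\<close>
    have "card T ^ (CARD('n) - 2) < card (R - {r})"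
      using m cardR r finR by simp
    also have "\<dots> \<le> card (?E \<inter> vec.span (R - {r}))"
      using R(1) card_cube(1)[OF T(1,2)] by (intro card_mono) (auto intro: vec.span_base)
    also have "\<dots> \<le> card T ^ vec.dim (vec.span (R - {r}))"
      by (rule card_cube_Int_subspace_le[OF T(1) vec.subspace_span])
    finally have "CARD('n) - 2 < vec.dim (R - {r})"
      using T(3) by (simp add: power_strict_increasing_iff)
    moreover have "e \<notin> vec.span (R - {r})" using e(2) vec.span_mono[of "R - {r}" R] by auto
    ultimately have "vec.dim (insert e (R - {r})) \<ge> CARD('n)" by (simp add: vec.dim_insert)
    moreover have "vec.dim (insert e (R - {r})) \<le> CARD('n)"
      using vec.dim_subset[of "insert e (R - {r})" UNIV] vec_dim_card[where 'a = 'a and 'n = 'n] by simp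
    ultimately have "vec.dim (insert e (R - {r})) = CARD('n)" by simp
    moreover have "c ` insert e (R - {r}) = c ` R"
      using r by (metis image_insert insert_Diff)
    moreover have "inj_on c (insert e (R - {r}))"
      using R(2) r by (auto simp: inj_on_def)
    ultimately show ?thesis using that[of "insert e (R - {r})"] R e(1) by auto
  qed
qed

text \<open>\<open>maximal_sparse\<close> is applied twice: inside the transversal \<open>R\<close>,
  where \<open>m\<close> yields a sparse \<open>J0\<close> with more than
  \<open>t * (CARD('n) - 1)\<close> colours, and then inside the cube, where \<open>room\<close>
  allows \<open>J0\<close> to be extended to a union of \<open>t\<close> disjoint bases.\<close>

theorem has_disjoint_rainbow_bases_cube:
  fixes T :: "'a::field set" and c :: "'a ^ 'n::finite \<Rightarrow> 'c"
  assumes T: "finite T" "0 \<in> T" "card T \<ge> 2" and d: "CARD('n) \<ge> 2" and "t > 0"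
    and room: "t * CARD('n) + 1 \<le> card T ^ CARD('n)"
    and m: "1 + t * (CARD('n) - 1) < card (c ` (cube T :: ('a ^ 'n) set))"
      "card T ^ (CARD('n) - 2) + t < card (c ` (cube T :: ('a ^ 'n) set))"
  shows "has_disjoint_rainbow_bases (cube T) c t"
proof -
  let ?E = "cube T :: ('a ^ 'n) set" and ?d = "CARD('n)"
  have finE: "finite ?E" and cardE: "card ?E = card T ^ ?d" using card_cube[OF T(1,2)] by auto
  have dim_le: "vec.dim F \<le> ?d" for F :: "('a ^ 'n) set"
    using vec.dim_subset[of F UNIV] vec_dim_card[where 'a = 'a and 'n = 'n] by simp
  have dimension: "vec.dimension TYPE('a) TYPE('n) = ?d"
    by (simp add: vec.dimension_def card_cart_basis)
  obtain R where R: "R \<subseteq> ?E" "inj_on c R" "c ` R = c ` ?E" "vec.dim R = ?d"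
    using spanning_transversal[OF T, of c] m(2) \<open>t > 0\<close> by auto
  have finR: "finite R" using R(1) finE finite_subset by blast
  have cardR: "card R = card (c ` ?E)" using R(2,3) by (metis card_image)
  obtain J0 F0 where J0: "J0 \<subseteq> R" "sparse vec.dim t J0" "vec.subspace F0"
      "card J0 = card (R - F0) + t * vec.dim F0"
    using vec.maximal_sparse[OF finR empty_subsetI _ \<open>t > 0\<close>] by (auto simp: sparse_def)
  have "t * (?d - 1) < card J0"
  proof (cases "vec.dim F0 \<le> ?d - 2")
    case True
    have "card (R \<inter> F0) \<le> card (?E \<inter> F0)" using R(1) finE by (intro card_mono) auto
    also have "\<dots> \<le> card T ^ vec.dim F0" by (rule card_cube_Int_subspace_le[OF T(1) J0(3)])
    finally have "card (R \<inter> F0) \<le> card T ^ vec.dim F0" .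
    \<comment> \<open>Subtracting 1 turns the strict bounds \<open>m\<close> into the two endpoint
      bounds and restores strictness in the conclusion.\<close>
    moreover have "card T ^ vec.dim F0 + t * ((?d - 2) + 1 - vec.dim F0) \<le> card R - 1"
    proof (rule power_add_linear_le)
      have "?d - 2 + 1 = ?d - 1" using d by simp
      then show "1 + t * (?d - 2 + 1) \<le> card R - 1" using m(1) cardR by simp
    qed (use T(3) True m(2) cardR in auto)
    moreover have "card R = card (R - F0) + card (R \<inter> F0)"
      using finR by (simp add: card_Diff_subset_Int card_mono)
    moreover have "t * ((?d - 2) + 1 - vec.dim F0) + t * vec.dim F0 = t * (?d - 1)"
      using True d by (simp flip: add_mult_distrib2)
    moreover have "card R > 0" using m(1) cardR by simp
    ultimately show ?thesis using J0(4) by linarith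
  next
    case False
    show ?thesis
    proof (cases "vec.dim F0 = ?d")
      case True
      then show ?thesis using J0(4) \<open>t > 0\<close> d by (simp add: trans_less_add2)
    next
      case ne: False
      then have "vec.dim F0 = ?d - 1" using False dim_le[of F0] by linarith
      \<comment> \<open>Since \<open>R\<close> spans, a point of it outside the hyperplane
        \<open>F0\<close> supplies the missing unit.\<close>
      moreover have "\<not> R \<subseteq> F0" using R(4) ne vec.dim_subset[of R F0] dim_le[of F0] by auto
      then have "card (R - F0) > 0" using finR by (auto simp: card_gt_0_iff)
      ultimately show ?thesis using J0(4) by simp
    qed
  qed
  obtain J F where J: "J0 \<subseteq> J" "J \<subseteq> ?E" "sparse vec.dim t J" "vec.subspace F"
      "card J = card (?E - F) + t * vec.dim F"
    using vec.maximal_sparse[OF finE _ J0(2) \<open>t > 0\<close>] J0(1) R(1) by (metis order_trans)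
  have finJ: "finite J" using J(2) finE finite_subset by blast
  have "t * ?d \<le> card J"
  proof -
    have "card T ^ vec.dim F + t * (?d - vec.dim F) \<le> card ?E"
      using T(3) room dim_le[of F] unfolding cardE by (intro power_add_linear_le_power) auto
    moreover have "card ?E = card (?E - F) + card (?E \<inter> F)"
      using finE by (simp add: card_Diff_subset_Int card_mono)
    moreover have "card (?E \<inter> F) \<le> card T ^ vec.dim F"
      by (rule card_cube_Int_subspace_le[OF T(1) J(4)])
    moreover have "t * (?d - vec.dim F) + t * vec.dim F = t * ?d"
      using dim_le[of F] by (simp flip: add_mult_distrib2)
    ultimately show ?thesis using J(5) by linarith
  qed
  obtain g where g: "g ` J \<subseteq> {..<t}" "\<forall>i<t. vec.independent {e\<in>J. g e = i}"
    using vec.sparse_partition[OF finJ J(3)] by blast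
  define B where "B i = {e\<in>J. g e = i}" for i
  have UnB: "(\<Union>i\<in>{..<t}. B i) = J" using g(1) by (auto simp: B_def)
  have disjB: "disjoint_family_on B {..<t}" by (auto simp: B_def disjoint_family_on_def)
  have card_B_le: "card (B i) \<le> ?d" if "i < t" for i
    using g(2) that vec.dim_eq_card_independent[of "B i"] dim_le[of "B i"] by (simp add: B_def)
  have "card J = (\<Sum>i<t. card (B i))"
    unfolding UnB[symmetric] using finJ disjB
    by (intro card_UN_disjoint) (auto simp: B_def disjoint_family_on_def)
  \<comment> \<open>There are at least \<open>t * ?d\<close> elements in \<open>t\<close>
    independent classes of size at most \<open>?d\<close>, so every class is a basis.\<close>
  then have "(\<Sum>i<t. card (B i)) = (\<Sum>i<t. ?d)"
    using \<open>t * ?d \<le> card J\<close> card_B_le sum_mono[of "{..<t}" "\<lambda>i. card (B i)" "\<lambda>_. ?d"] by simp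
  then have card_B: "card (B i) = ?d" if "i < t" for i
    using sum_mono_inv[of "\<lambda>i. card (B i)" "{..<t}" "\<lambda>i. ?d" i] card_B_le that by auto
  \<comment> \<open>Points of \<open>J0\<close> lie in the transversal, so they have distinct
    colours.\<close>
  have "t * (?d - 1) < card (c ` J0)"
    using \<open>t * (?d - 1) < card J0\<close> R(2) J0(1) by (simp add: card_image inj_on_subset)
  also have "\<dots> \<le> card (c ` J)" using finJ J(1) by (intro card_mono) auto
  finally have "card {..<t} * (vec.dimension TYPE('a) TYPE('n) - 1) < card (c ` (\<Union>i\<in>{..<t}. B i))"
    unfolding UnB dimension by simp
  then obtain B' where B': "\<forall>i\<in>{..<t}. vec.independent (B' i) \<and> card (B' i) = ?d \<and> inj_on c (B' i)"
      "disjoint_family_on B' {..<t}" "(\<Union>i\<in>{..<t}. B' i) = J"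
    using vec.rainbow_rearrangement[of "{..<t}" B c] card_B g(2) disjB UnB
    unfolding dimension by (auto simp: B_def)
  have inj: "inj_on B' {..<t}"
  proof (rule inj_onI)
    fix i j assume ij: "i \<in> {..<t}" "j \<in> {..<t}" "B' i = B' j"
    have "B' i \<noteq> {}" using B'(1) ij(1) d by (metis card.empty not_numeral_le_zero)
    then show "i = j" using B'(2) ij by (auto simp: disjoint_family_on_def)
  qed
  have "pairwise disjnt (B' ` {..<t})"
    using B'(2) unfolding pairwise_def disjnt_def disjoint_family_on_def
    by (metis (no_types, lifting) imageE)
  moreover have "rainbow_basis ?E c (B' i)" if "i < t" for i
    using that B'(1,3) J(2) by (auto simp: rainbow_basis_def basis_of_def)
  ultimately show ?thesis
    unfolding has_disjoint_rainbow_bases_def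
    using inj by (intro exI[of _ "B' ` {..<t}"]) (auto simp: card_image)
qed

section \<open>The anti-Ramsey number of the cube\<close>

lemma sum_card_Int_disjoint_le:
  assumes "finite \<B>" "pairwise disjnt \<B>" "finite A"
  shows "(\<Sum>B\<in>\<B>. card (B \<inter> A)) \<le> card A"
proof -
  have "(\<Sum>B\<in>\<B>. card (B \<inter> A)) = card (\<Union>B\<in>\<B>. B \<inter> A)"
    using assms by (intro card_UN_disjoint[symmetric]) (auto simp: pairwise_def disjnt_def)
  also have "\<dots> \<le> card A" using assms(3) by (intro card_mono) auto
  finally show ?thesis .
qed

text \<open>A rainbow basis has at most \<open>k\<close> points in the coordinate subspace and at
  most one of the leftover colour, so it has at least \<open>CARD('n) - 1 - k\<close> among the
  further points. By \<open>room\<close> and convexity there are enough points outside the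
  subspace.\<close>

lemma colouring_without_disjoint_rainbow_bases:
  fixes T :: "'a::field set"
  assumes T: "finite T" "0 \<in> T" "card T \<ge> 2" and "t > 0" and k: "k + 2 \<le> CARD('n::finite)"
    and room: "t * CARD('n) + 1 \<le> card T ^ CARD('n)"
  shows "\<exists>c :: 'a ^ 'n \<Rightarrow> nat. card (c ` cube T) = card T ^ k + t * (CARD('n) - 1 - k) \<and>
    \<not> has_disjoint_rainbow_bases (cube T) c t"
proof -
  let ?E = "cube T :: ('a ^ 'n) set" and ?d = "CARD('n)"
  have finE: "finite ?E" and cardE: "card ?E = card T ^ ?d" using card_cube[OF T(1,2)] by auto
  obtain K :: "'n set" where K: "card K = k"
    using k obtain_subset_with_card_n[of k "UNIV :: 'n set"] by auto
  define F where "F = {x \<in> ?E. \<forall>i. i \<notin> K \<longrightarrow> x $ i = 0}"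
  have F: "F \<subseteq> ?E" "finite F" "card F = card T ^ k"
    using card_cube_supported[OF T(1,2), of K] K by (auto simp: F_def)
  define s where "s = t * (?d - 1 - k)"
  have "s > 0" using k \<open>t > 0\<close> by (auto simp: s_def)
  have "card T ^ k + t * (?d - k) \<le> card ?E"
    unfolding cardE using T(3) room k by (intro power_add_linear_le_power) auto
  moreover have "s \<le> t * (?d - k)" unfolding s_def by (intro mult_le_mono2) simp
  ultimately have s_le: "s \<le> card (?E - F)" using F by (simp add: card_Diff_subset)
  \<comment> \<open>One point fewer than \<open>t\<close> disjoint rainbow bases would consume; the
    leftover colour makes up for it in the number of colours.\<close>
  obtain A where A: "A \<subseteq> ?E - F" "card A = s - 1" "finite A"
    using s_le obtain_subset_with_card_n[of "s - 1" "?E - F"] by (metis diff_le_self le_trans)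
  let ?U = "F \<union> A"
  have cardU: "card ?U = card T ^ k + (s - 1)"
    using A F by (subst card_Un_disjoint) auto
  obtain h where h: "bij_betw h ?U {0..<card ?U}"
    using ex_bij_betw_finite_nat[of ?U] F(2) A(3) by auto
  define c where "c x = (if x \<in> ?U then h x else card ?U)" for x
  have "\<not> ?E \<subseteq> ?U"
  proof
    assume "?E \<subseteq> ?U"
    then have "?E - F \<subseteq> A" by blast
    then have "card (?E - F) \<le> card A" using A(3) by (rule card_mono[rotated])
    then show False using A(2) s_le \<open>s > 0\<close> by linarith
  qed
  then have "c ` ?E = c ` ?U \<union> {card ?U}" using F(1) A(1) by (auto simp: c_def)
  also have "c ` ?U = {0..<card ?U}"
    using bij_betw_imp_surj_on[OF h] by (metis (no_types, lifting) c_def image_cong)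
  also have "{0..<card ?U} \<union> {card ?U} = {0..<Suc (card ?U)}" by auto
  finally have "card (c ` ?E) = card T ^ k + s" using cardU \<open>s > 0\<close> by simp
  moreover have "\<not> has_disjoint_rainbow_bases ?E c t"
  proof
    assume "has_disjoint_rainbow_bases ?E c t"
    then obtain \<B> where \<B>: "finite \<B>" "card \<B> = t" "\<forall>B\<in>\<B>. rainbow_basis ?E c B" "pairwise disjnt \<B>"
      by (auto simp: has_disjoint_rainbow_bases_def)
    have "?d - 1 - k \<le> card (B \<inter> A)" if "B \<in> \<B>" for B
    proof -
      have B: "B \<subseteq> ?E" "vec.independent B" "card B = ?d" "inj_on c B"
        using \<B>(3) that by (auto simp: rainbow_basis_def basis_of_def)
      have finB: "finite B" using B(1) finE finite_subset by blast
      have "card (B \<inter> F) \<le> vec.dim {x :: 'a ^ 'n. \<forall>i. i \<notin> K \<longrightarrow> x $ i = 0}"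
        by (intro vec.independent_card_le_dim vec.independent_mono[OF B(2)]) (auto simp: F_def)
      then have "card (B \<inter> F) \<le> k" by (simp add: dim_substandard_cart K)
      moreover have "card (B - ?U) \<le> 1"
      proof -
        have "card (B - ?U) = card (c ` (B - ?U))"
          using B(4) by (metis Diff_subset card_image inj_on_subset)
        also have "\<dots> \<le> card {card ?U}" by (intro card_mono) (auto simp: c_def)
        finally show ?thesis by simp
      qed
      moreover have "card B \<le> card (B \<inter> F) + card (B \<inter> A) + card (B - ?U)"
      proof -
        have "B = (B \<inter> F) \<union> (B \<inter> A) \<union> (B - ?U)" by blast
        then show ?thesis by (metis add_le_mono1 card_Un_le order_trans)
      qed
      ultimately show ?thesis using B(3) by linarith
    qed
    then have "s \<le> (\<Sum>B\<in>\<B>. card (B \<inter> A))"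
      using \<B>(2) sum_bounded_below[of \<B> "?d - 1 - k" "\<lambda>B. card (B \<inter> A)"] by (simp add: s_def)
    also have "\<dots> \<le> card A" using \<B> A(3) by (intro sum_card_Int_disjoint_le)
    finally show False using A(2) \<open>s > 0\<close> by simp
  qed
  ultimately show ?thesis unfolding s_def by blast
qed

text \<open>The zero vector lies in no basis, which accounts for the \<open>+ 1\<close>.\<close>

lemma disjoint_rainbow_bases_card_le:
  fixes E :: "('a::field ^ 'n::finite) set"
  assumes "finite E" "0 \<in> E" "has_disjoint_rainbow_bases E c t"
  shows "t * CARD('n) + 1 \<le> card E"
proof -
  obtain \<B> where \<B>: "finite \<B>" "card \<B> = t" "\<forall>B\<in>\<B>. rainbow_basis E c B" "pairwise disjnt \<B>"
    using assms(3) by (auto simp: has_disjoint_rainbow_bases_def)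
  have "card (B \<inter> (E - {0})) = CARD('n)" if "B \<in> \<B>" for B
  proof -
    have B: "B \<subseteq> E" "vec.independent B" "card B = CARD('n)"
      using \<B>(3) that by (auto simp: rainbow_basis_def basis_of_def)
    then have "B \<inter> (E - {0}) = B" using vec.dependent_zero by blast
    then show ?thesis using B(3) by simp
  qed
  then have "t * CARD('n) = (\<Sum>B\<in>\<B>. card (B \<inter> (E - {0})))" using \<B>(2) by simp
  also have "\<dots> \<le> card (E - {0})" using \<B> assms(1) by (intro sum_card_Int_disjoint_le) auto
  finally show ?thesis using assms(1,2) card_Suc_Diff1[of E 0] by simp
qed

lemma ar_lin_eqI:
  fixes E :: "('a::field ^ 'n::finite) set"
  assumes "finite E"
    and "\<exists>c :: 'a ^ 'n \<Rightarrow> nat. card (c ` E) = m \<and> \<not> has_disjoint_rainbow_bases E c t"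
    and "\<And>c :: 'a ^ 'n \<Rightarrow> nat. \<not> has_disjoint_rainbow_bases E c t \<Longrightarrow> card (c ` E) \<le> m"
  shows "ar_lin E t = m"
  unfolding ar_lin_def
proof (rule Max_eqI)
  show "finite {m. \<exists>c :: 'a ^ 'n \<Rightarrow> nat. card (c ` E) = m \<and> \<not> has_disjoint_rainbow_bases E c t}"
    by (rule finite_subset[of _ "{..m}"]) (use assms(3) in auto)
qed (use assms in auto)

text \<open>If \<open>t * d + 1\<close> is at most \<open>card T ^ d\<close>, the value is the
  maximum of the last two formulas, and the side conditions decide which is larger. Otherwise
  \<open>t\<close> disjoint bases do not fit, and all points may get distinct colours.\<close>

theorem theorem20:
  fixes T :: "'a::field set" and d t :: nat
  assumes "finite T" and "0 \<in> T" and "card T \<ge> 2"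
    and "d = CARD('n::finite)" and "d \<ge> 2" and "t > 0"
  shows "(real t > (real (card T) ^ d - 1) / real d \<longrightarrow>
            ar_lin (cube T :: ('a ^ 'n) set) t = card T ^ d) \<and>
         (t * (d - 2) \<ge> card T ^ (d - 2) - 1 \<and> real t \<le> (real (card T) ^ d - 1) / real d \<longrightarrow>
            ar_lin (cube T :: ('a ^ 'n) set) t = 1 + t * (d - 1)) \<and>
         (t * (d - 2) \<le> card T ^ (d - 2) - 1 \<and> (d = 2 \<longrightarrow> real t \<le> (real (card T) ^ d - 1) / real d) \<longrightarrow>
            ar_lin (cube T :: ('a ^ 'n) set) t = card T ^ (d - 2) + t)"
proof -
  let ?E = "cube T :: ('a ^ 'n) set"
  note d = \<open>d = CARD('n)\<close>
  have finE: "finite ?E" and cardE: "card ?E = card T ^ d" using card_cube[OF assms(1,2)] d by auto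
  have q_pos: "card T ^ n \<ge> 1" for n using assms(3) by simp
  have real_iff: "real t \<le> (real (card T) ^ d - 1) / real d \<longleftrightarrow> t * d + 1 \<le> card T ^ d"
  proof -
    have "real t \<le> (real (card T) ^ d - 1) / real d \<longleftrightarrow> real (t * d + 1) \<le> real (card T ^ d)"
      using assms(5) by (simp add: le_divide_eq algebra_simps)
    then show ?thesis by (simp only: of_nat_le_iff)
  qed
  have small: "ar_lin ?E t = max (1 + t * (d - 1)) (card T ^ (d - 2) + t)" if room: "t * d + 1 \<le> card T ^ d"
  proof (rule ar_lin_eqI[OF finE])
    have "\<exists>k. k + 2 \<le> d \<and> card T ^ k + t * (d - 1 - k) = max (1 + t * (d - 1)) (card T ^ (d - 2) + t)"
    proof (cases "1 + t * (d - 1) \<le> card T ^ (d - 2) + t")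
      case True
      have "d - 1 - (d - 2) = 1" using assms(5) by simp
      then show ?thesis using True assms(5) by (intro exI[of _ "d - 2"]) simp
    next
      case False
      then show ?thesis using assms(5) by (intro exI[of _ 0]) simp
    qed
    then show "\<exists>c :: 'a ^ 'n \<Rightarrow> nat. card (c ` ?E) = max (1 + t * (d - 1)) (card T ^ (d - 2) + t) \<and>
        \<not> has_disjoint_rainbow_bases ?E c t"
      using colouring_without_disjoint_rainbow_bases[OF assms(1-3,6), where 'n = 'n] room d by metis
    fix c :: "'a ^ 'n \<Rightarrow> nat" assume "\<not> has_disjoint_rainbow_bases ?E c t"
    then show "card (c ` ?E) \<le> max (1 + t * (d - 1)) (card T ^ (d - 2) + t)"
      using has_disjoint_rainbow_bases_cube[OF assms(1-3), of t c] assms(5,6) room d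
      by (fastforce simp: not_less)
  qed
  have large: "ar_lin ?E t = card T ^ d" if "\<not> t * d + 1 \<le> card T ^ d"
  proof (rule ar_lin_eqI[OF finE])
    have "0 \<in> ?E" using assms(2) by (simp add: cube_def)
    then have "\<not> has_disjoint_rainbow_bases ?E c t" for c :: "'a ^ 'n \<Rightarrow> nat"
      using disjoint_rainbow_bases_card_le[OF finE] that cardE d by metis
    moreover obtain c :: "'a ^ 'n \<Rightarrow> nat" where "inj_on c ?E"
      using finite_imp_inj_to_nat_seg[OF finE] by blast
    ultimately show "\<exists>c :: 'a ^ 'n \<Rightarrow> nat. card (c ` ?E) = card T ^ d \<and> \<not> has_disjoint_rainbow_bases ?E c t"
      using cardE by (metis card_image)
    show "card (c ` ?E) \<le> card T ^ d" for c :: "'a ^ 'n \<Rightarrow> nat"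
      using card_image_le[OF finE, of c] cardE by simp
  qed
  have split: "t * (d - 1) = t * (d - 2) + t"
  proof -
    have "d - 1 = (d - 2) + 1" using assms(5) by simp
    then show ?thesis by (metis add_mult_distrib2 mult.right_neutral)
  qed
  \<comment> \<open>For \<open>d > 2\<close> the third side condition already bounds
    \<open>t\<close>: with \<open>n = d - 2\<close> it gives
    \<open>t * d + 1 \<le> 3 * card T ^ n\<close>, and \<open>3 \<le> card T ^ 2\<close>. For
    \<open>d = 2\<close> it reads \<open>0 \<le> 0\<close>, so there the bound on \<open>t\<close>
    is assumed.\<close>
  have room: "t * d + 1 \<le> card T ^ d" if "t * (d - 2) \<le> card T ^ (d - 2) - 1" "d \<noteq> 2"
  proof -
    define n where "n = d - 2"
    have n: "d = n + 2" "n \<ge> 1" using assms(5) that(2) by (auto simp: n_def)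
    have tn: "t * n + 1 \<le> card T ^ n" using that(1) q_pos[of n] n by simp
    then have "t * 1 \<le> card T ^ n" using n(2) mult_le_mono2[of 1 n t] by linarith
    moreover have "t * d = t * n + 2 * t" using n(1) by simp
    ultimately have "t * d + 1 \<le> 3 * card T ^ n" using tn by linarith
    also have "\<dots> \<le> card T ^ 2 * card T ^ n"
      using power_mono[OF assms(3), of 2] by (intro mult_le_mono1) simp
    finally show ?thesis using n(1) by (metis add.commute power_add)
  qed
  show ?thesis
  proof (intro conjI impI)
    assume "real t > (real (card T) ^ d - 1) / real d"
    then show "ar_lin ?E t = card T ^ d" using real_iff by (intro large) linarith
  next
    assume *: "t * (d - 2) \<ge> card T ^ (d - 2) - 1 \<and> real t \<le> (real (card T) ^ d - 1) / real d"
    then have "card T ^ (d - 2) + t \<le> 1 + t * (d - 1)" using split by linarith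
    then show "ar_lin ?E t = 1 + t * (d - 1)"
      using * small real_iff by (simp only: max.absorb1)
  next
    assume *: "t * (d - 2) \<le> card T ^ (d - 2) - 1 \<and>
      (d = 2 \<longrightarrow> real t \<le> (real (card T) ^ d - 1) / real d)"
    then have "t * d + 1 \<le> card T ^ d" using room real_iff by blast
    moreover have "1 + t * (d - 1) \<le> card T ^ (d - 2) + t"
      using * split q_pos[of "d - 2"] by linarith
    ultimately show "ar_lin ?E t = card T ^ (d - 2) + t"
      using small by (simp only: max.absorb2)
  qed
qed

end
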